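(* Let $S$ be a scheme, $M$ a commutative monoid, $X$ an $S$-algebraic space endowed with an action of $A(M)_S$, and $N\subset M$ a submonoid. (i) If $X$ is a monoid algebraic space over $S$ and the action of $A(M)_S$ on $X$ is by monoid endomorphisms, then the attractor $X^N$ is a monoid functor. (ii) If $X$ is a group algebraic space over $S$ and the action of $A(M)_S$ on $X$ is by group automorphisms, then $X^N$ is a group functor.
   Context: All monoids denoted $M,N$ are commutative. For a monoid $N$, $\mathbb{Z}[N]=\bigoplus_{n\in N}\mathbb{Z}X^n$ with $X^nX^{n'}=X^{n+n'}$, $A(N)=\mathrm{Spec}(\mathbb{Z}[N])$ is a monoid scheme (comultiplication $X^n\mapsto X^n\otimes X^n$, counit $X^n\mapsto 1$), and $A(N)_S$ is its base change to $S$. If $N\subset M$ is a submonoid, $A(M)_S$ acts on $A(N)_S$ via $X^n\mapsto X^n\otimes X^n$. The attractor $X^N$ is the functor on $S$-schemes sending $T$ to the set $\mathrm{Hom}_T^{A(M)_T}(A(N)_T,X_T)$ of $A(M)_T$-equivariant $T$-morphisms $A(N)_T\to X_T=X\times_S T$, with functoriality by base change. The law on $X^N(T)$ is pointwise multiplication of morphisms $A(N)_T\to X_T$. *)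

theory Defs
  imports "HOL-Algebra.RingHom" "HOL-Library.Poly_Mapping"
begin

section \<open>Functors of points\<close>

text \<open>
  Schemes and algebraic spaces are treated as functors of points, in the style of
  Demazure--Gabriel (schemes) and Laumon--Moret-Bailly (algebraic spaces): an object is a
  set-valued functor on commutative rings (the opposite of the category of affine schemes), and
  all geometric notions are conditions on such functors.  As always with functors of points one
  fixes a universe of small rings: here, the commutative rings whose carrier is a set of elements
  of a type \<open>'u\<close>.  For infinite \<open>'u\<close> these rings are closed under quotients, localisations,
  finitely generated algebras, tensor products and residue fields, i.e. under every ring
  construction occurring below.  The type \<open>'u\<close> is a type variable, hence arbitrary; the intended
  case is that \<open>'u\<close> is infinite and large enough for the given \<open>S\<close>, \<open>X\<close>, \<open>T\<close> and \<open>M\<close>.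

  Over a base \<open>S\<close>, a functor on affine schemes over \<open>S\<close> is the same as a functor \<open>X\<close> with a
  morphism \<open>\<pi> : X \<rightarrow> S\<close>; objects over \<open>S\<close> are such pairs.
\<close>

text \<open>Ring homomorphisms, made extensional so that a morphism of rings is a single function.\<close>

definition rhom :: "'a ring \<Rightarrow> 'b ring \<Rightarrow> ('a \<Rightarrow> 'b) set" where
  "rhom A B = ring_hom A B \<inter> extensional (carrier A)"

record ('u, 'x) zfun =
  pts :: "'u ring \<Rightarrow> 'x set"
  tr :: "'u ring \<Rightarrow> 'u ring \<Rightarrow> ('u \<Rightarrow> 'u) \<Rightarrow> 'x \<Rightarrow> 'x"

definition is_zfun :: "('u, 'x) zfun \<Rightarrow> bool" where
  "is_zfun F \<longleftrightarrow>
     (\<forall>A B h. cring A \<and> cring B \<and> h \<in> rhom A B \<longrightarrow> tr F A B h \<in> pts F A \<rightarrow> pts F B) \<and>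
     (\<forall>A. cring A \<longrightarrow> (\<forall>x\<in>pts F A. tr F A A (\<lambda>a\<in>carrier A. a) x = x)) \<and>
     (\<forall>A B C h k. cring A \<and> cring B \<and> cring C \<and> h \<in> rhom A B \<and> k \<in> rhom B C \<longrightarrow>
        (\<forall>x\<in>pts F A. tr F A C (compose (carrier A) k h) x = tr F B C k (tr F A B h x)))"

type_synonym ('u, 'x, 'y) nt = "'u ring \<Rightarrow> 'x \<Rightarrow> 'y"

text \<open>Natural transformations, again extensional, so that equality of morphisms is equality.\<close>

definition NT :: "('u, 'x) zfun \<Rightarrow> ('u, 'y) zfun \<Rightarrow> ('u, 'x, 'y) nt set" where
  "NT F G = {\<eta>. \<eta> \<in> (\<Pi>\<^sub>E A\<in>{A. cring A}. pts F A \<rightarrow>\<^sub>E pts G A) \<and>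
     (\<forall>A B h. cring A \<and> cring B \<and> h \<in> rhom A B \<longrightarrow>
        (\<forall>x\<in>pts F A. \<eta> B (tr F A B h x) = tr G A B h (\<eta> A x)))}"

definition mkNT :: "('u, 'x) zfun \<Rightarrow> ('u, 'x, 'y) nt \<Rightarrow> ('u, 'x, 'y) nt" where
  "mkNT F \<eta> = (\<lambda>A\<in>{A. cring A}. \<lambda>x\<in>pts F A. \<eta> A x)"

definition idNT :: "('u, 'x) zfun \<Rightarrow> ('u, 'x, 'x) nt" where
  "idNT F = mkNT F (\<lambda>A x. x)"

definition compNT ::
  "('u, 'x) zfun \<Rightarrow> ('u, 'y, 'z) nt \<Rightarrow> ('u, 'x, 'y) nt \<Rightarrow> ('u, 'x, 'z) nt" where
  "compNT F \<theta> \<eta> = mkNT F (\<lambda>A x. \<theta> A (\<eta> A x))"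

definition over_hom ::
  "('u, 'x) zfun \<Rightarrow> ('u, 'x, 's) nt \<Rightarrow> ('u, 'y) zfun \<Rightarrow> ('u, 'y, 's) nt \<Rightarrow> ('u, 'x, 'y) nt set" where
  "over_hom X \<pi> Y \<rho> = {\<eta> \<in> NT X Y. \<forall>A. cring A \<longrightarrow> (\<forall>x\<in>pts X A. \<rho> A (\<eta> A x) = \<pi> A x)}"

definition prodF :: "('u, 'x) zfun \<Rightarrow> ('u, 'y) zfun \<Rightarrow> ('u, 'x \<times> 'y) zfun" where
  "prodF X Y = \<lparr>pts = (\<lambda>A. pts X A \<times> pts Y A),
                tr = (\<lambda>A B h (x, y). (tr X A B h x, tr Y A B h y))\<rparr>"

definition fibprod ::
  "('u, 'x) zfun \<Rightarrow> ('u, 'x, 's) nt \<Rightarrow> ('u, 'y) zfun \<Rightarrow> ('u, 'y, 's) nt \<Rightarrow> ('u, 'x \<times> 'y) zfun" where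
  "fibprod X \<pi> Y \<rho> = \<lparr>pts = (\<lambda>A. {(x, y). x \<in> pts X A \<and> y \<in> pts Y A \<and> \<pi> A x = \<rho> A y}),
                       tr = (\<lambda>A B h (x, y). (tr X A B h x, tr Y A B h y))\<rparr>"

text \<open>The ring \<open>A\<close> of \<open>Spec A\<close> may have elements of any type.\<close>

definition Spec :: "'a ring \<Rightarrow> ('u, 'a \<Rightarrow> 'u) zfun" where
  "Spec A = \<lparr>pts = (\<lambda>R. rhom A R), tr = (\<lambda>R R' h g. compose (carrier A) h g)\<rparr>"

text \<open>The morphism \<open>Spec A \<rightarrow> F\<close> which corresponds to \<open>x \<in> F(A)\<close> by the Yoneda lemma.\<close>

definition yoneda :: "('u, 'x) zfun \<Rightarrow> 'u ring \<Rightarrow> 'x \<Rightarrow> ('u, 'u \<Rightarrow> 'u, 'x) nt" where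
  "yoneda F A x = mkNT (Spec A) (\<lambda>R g. tr F A R g x)"


section \<open>Sheaves, schemes\<close>

definition is_localization :: "'u ring \<Rightarrow> 'u \<Rightarrow> 'u ring \<Rightarrow> ('u \<Rightarrow> 'u) \<Rightarrow> bool" where
  "is_localization A f B h \<longleftrightarrow> h \<in> rhom A B \<and> h f \<in> Units B \<and>
     (\<forall>C :: 'u ring. cring C \<longrightarrow> (\<forall>g\<in>rhom A C. g f \<in> Units C \<longrightarrow>
        (\<exists>!k. k \<in> rhom B C \<and> compose (carrier A) k h = g)))"

text \<open>A covering family of \<open>Spec A\<close> is given as a finite set of pairs \<open>(B, h : A \<rightarrow> B)\<close>; finite
  families suffice because \<open>Spec A\<close> is quasi-compact.\<close>

definition zariski_cover :: "'u ring \<Rightarrow> ('u ring \<times> ('u \<Rightarrow> 'u)) set \<Rightarrow> bool" where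
  "zariski_cover A \<C> \<longleftrightarrow> finite \<C> \<and>
     (\<exists>f. (\<forall>(B, h)\<in>\<C>. cring B \<and> f (B, h) \<in> carrier A \<and> is_localization A (f (B, h)) B h) \<and>
          genideal A (f ` \<C>) = carrier A)"

definition sheaf_for ::
  "('u, 'x) zfun \<Rightarrow> 'u ring \<Rightarrow> ('u ring \<times> ('u \<Rightarrow> 'u)) set \<Rightarrow> bool" where
  "sheaf_for F A \<C> \<longleftrightarrow>
     (\<forall>x. (\<forall>(B, h)\<in>\<C>. x (B, h) \<in> pts F B) \<and>
          (\<forall>(B, h)\<in>\<C>. \<forall>(B', h')\<in>\<C>. \<forall>D g g'.
             cring D \<and> g \<in> rhom B D \<and> g' \<in> rhom B' D \<and>
             compose (carrier A) g h = compose (carrier A) g' h' \<longrightarrow>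
             tr F B D g (x (B, h)) = tr F B' D g' (x (B', h'))) \<longrightarrow>
          (\<exists>!y. y \<in> pts F A \<and> (\<forall>(B, h)\<in>\<C>. tr F A B h y = x (B, h))))"

definition zariski_sheaf :: "('u, 'x) zfun \<Rightarrow> bool" where
  "zariski_sheaf F \<longleftrightarrow> is_zfun F \<and>
     (\<forall>A \<C>. cring A \<and> zariski_cover A \<C> \<longrightarrow> sheaf_for F A \<C>)"

text \<open>A subfunctor \<open>U \<subseteq> F\<close> is open if its inverse image under every morphism \<open>Spec A \<rightarrow> F\<close> is the
  open subfunctor \<open>D(I) \<subseteq> Spec A\<close> of some ideal \<open>I\<close>, where \<open>g : A \<rightarrow> R\<close> lies in \<open>D(I)(R)\<close> iff
  \<open>g(I)\<close> generates the unit ideal of \<open>R\<close>.  (Stability of \<open>U\<close> under \<open>tr\<close> follows.)\<close>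

definition open_subfunctor :: "('u, 'x) zfun \<Rightarrow> ('u ring \<Rightarrow> 'x set) \<Rightarrow> bool" where
  "open_subfunctor F U \<longleftrightarrow> (\<forall>A. cring A \<longrightarrow> U A \<subseteq> pts F A) \<and>
     (\<forall>A. cring A \<longrightarrow> (\<forall>x\<in>pts F A. \<exists>I. ideal I A \<and>
        (\<forall>R. cring R \<longrightarrow> (\<forall>g\<in>rhom A R.
           tr F A R g x \<in> U R \<longleftrightarrow> genideal R (g ` I) = carrier R))))"

text \<open>\<open>w \<in> F(B)\<close> is an affine open chart if the corresponding \<open>Spec B \<rightarrow> F\<close> is an isomorphism onto
  an open subfunctor.\<close>

definition open_chart :: "('u, 'x) zfun \<Rightarrow> 'u ring \<Rightarrow> 'x \<Rightarrow> bool" where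
  "open_chart F B w \<longleftrightarrow> cring B \<and> w \<in> pts F B \<and>
     (\<forall>R. cring R \<longrightarrow> inj_on (yoneda F B w R) (rhom B R)) \<and>
     open_subfunctor F (\<lambda>R. yoneda F B w R ` rhom B R)"

text \<open>Open subfunctors cover iff they do so on points with values in fields.\<close>

definition scheme :: "('u, 'x) zfun \<Rightarrow> bool" where
  "scheme F \<longleftrightarrow> zariski_sheaf F \<and>
     (\<forall>K. field K \<longrightarrow> (\<forall>x\<in>pts F K. \<exists>B w. open_chart F B w \<and> x \<in> yoneda F B w K ` rhom B K))"


section \<open>Etale morphisms, algebraic spaces\<close>

text \<open>The polynomial ring \<open>A[x\<^sub>0, \<dots>, x\<^bsub>n-1\<^esub>]\<close>; a polynomial is its family of coefficients.\<close>

definition mpoly_ring :: "'a ring \<Rightarrow> nat \<Rightarrow> ((nat \<Rightarrow>\<^sub>0 nat) \<Rightarrow> 'a) ring" where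
  "mpoly_ring A n =
     \<lparr>carrier = {p. (\<forall>m. p m \<in> carrier A) \<and> finite {m. p m \<noteq> \<zero>\<^bsub>A\<^esub>} \<and>
                    (\<forall>m. p m \<noteq> \<zero>\<^bsub>A\<^esub> \<longrightarrow> Poly_Mapping.keys m \<subseteq> {..<n})},
      monoid.mult = (\<lambda>p q m. \<Oplus>\<^bsub>A\<^esub>i\<in>{(k, l). k + l = m}. p (fst i) \<otimes>\<^bsub>A\<^esub> q (snd i)),
      one = (\<lambda>m. if m = 0 then \<one>\<^bsub>A\<^esub> else \<zero>\<^bsub>A\<^esub>),
      zero = (\<lambda>m. \<zero>\<^bsub>A\<^esub>),
      add = (\<lambda>p q m. p m \<oplus>\<^bsub>A\<^esub> q m)\<rparr>"

definition mpoly_const :: "'a ring \<Rightarrow> 'a \<Rightarrow> (nat \<Rightarrow>\<^sub>0 nat) \<Rightarrow> 'a" where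
  "mpoly_const A c = (\<lambda>m. if m = 0 then c else \<zero>\<^bsub>A\<^esub>)"

definition finitely_presented :: "'u ring \<Rightarrow> 'u ring \<Rightarrow> ('u \<Rightarrow> 'u) \<Rightarrow> bool" where
  "finitely_presented A B h \<longleftrightarrow>
     (\<exists>n. \<exists>\<psi>\<in>ring_hom (mpoly_ring A n) B.
        (\<forall>c\<in>carrier A. \<psi> (mpoly_const A c) = h c) \<and>
        \<psi> ` carrier (mpoly_ring A n) = carrier B \<and>
        (\<exists>G. finite G \<and> G \<subseteq> carrier (mpoly_ring A n) \<and>
             a_kernel (mpoly_ring A n) B \<psi> = genideal (mpoly_ring A n) G))"

text \<open>Unique lifting along surjections \<open>p : C \<rightarrow> D\<close> with square-zero kernel (EGA IV 17.1.1, 17.3.1).\<close>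

definition formally_etale :: "'u ring \<Rightarrow> 'u ring \<Rightarrow> ('u \<Rightarrow> 'u) \<Rightarrow> bool" where
  "formally_etale A B h \<longleftrightarrow>
     (\<forall>(C :: 'u ring) (D :: 'u ring) p v u. cring C \<and> cring D \<and> p \<in> rhom C D \<and> p ` carrier C = carrier D \<and>
        (\<forall>x\<in>a_kernel C D p. \<forall>y\<in>a_kernel C D p. x \<otimes>\<^bsub>C\<^esub> y = \<zero>\<^bsub>C\<^esub>) \<and>
        v \<in> rhom A C \<and> u \<in> rhom B D \<and> compose (carrier A) p v = compose (carrier A) u h \<longrightarrow>
        (\<exists>!w. w \<in> rhom B C \<and> compose (carrier A) w h = v \<and> compose (carrier B) p w = u))"

definition etale_ring_map :: "'u ring \<Rightarrow> 'u ring \<Rightarrow> ('u \<Rightarrow> 'u) \<Rightarrow> bool" where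
  "etale_ring_map A B h \<longleftrightarrow> cring A \<and> cring B \<and> h \<in> rhom A B \<and>
     finitely_presented A B h \<and> formally_etale A B h"

definition etale_cover :: "'u ring \<Rightarrow> ('u ring \<times> ('u \<Rightarrow> 'u)) set \<Rightarrow> bool" where
  "etale_cover A \<C> \<longleftrightarrow> finite \<C> \<and> (\<forall>(B, h)\<in>\<C>. etale_ring_map A B h) \<and>
     (\<forall>P. primeideal P A \<longrightarrow>
        (\<exists>(B, h)\<in>\<C>. \<exists>Q. primeideal Q B \<and> P = {a \<in> carrier A. h a \<in> Q}))"

definition etale_sheaf :: "('u, 'x) zfun \<Rightarrow> bool" where
  "etale_sheaf F \<longleftrightarrow> is_zfun F \<and>
     (\<forall>A \<C>. cring A \<and> etale_cover A \<C> \<longrightarrow> sheaf_for F A \<C>)"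

text \<open>Morphisms \<open>F \<rightarrow> G\<close> representable by schemes: \<open>F \<times>\<^sub>G Spec A\<close> is a scheme for all \<open>Spec A \<rightarrow> G\<close>.\<close>

definition schematic :: "('u, 'x) zfun \<Rightarrow> ('u, 'y) zfun \<Rightarrow> ('u, 'x, 'y) nt \<Rightarrow> bool" where
  "schematic F G f \<longleftrightarrow> f \<in> NT F G \<and>
     (\<forall>A. cring A \<longrightarrow> (\<forall>y\<in>pts G A. scheme (fibprod F f (Spec A) (yoneda G A y))))"

text \<open>For a scheme \<open>V\<close> and \<open>q : V \<rightarrow> Spec A\<close>.  A chart \<open>w \<in> V(B)\<close> has image \<open>q(w) : A \<rightarrow> B\<close>.  The
  image of a point \<open>v \<in> V(K)\<close>, \<open>K\<close> a field, is the prime ideal \<open>ker (q(v) : A \<rightarrow> K)\<close>.\<close>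

definition etale_surjective_on ::
  "'u ring \<Rightarrow> ('u, 'x) zfun \<Rightarrow> ('u, 'x, 'u \<Rightarrow> 'u) nt \<Rightarrow> bool" where
  "etale_surjective_on A V q \<longleftrightarrow>
     (\<forall>B w. open_chart V B w \<longrightarrow> etale_ring_map A B (q B w)) \<and>
     (\<forall>P. primeideal P A \<longrightarrow> (\<exists>K. field K \<and> (\<exists>v\<in>pts V K. a_kernel A K (q K v) = P)))"

definition etale_surjective ::
  "('u, 'x) zfun \<Rightarrow> ('u, 'y) zfun \<Rightarrow> ('u, 'x, 'y) nt \<Rightarrow> bool" where
  "etale_surjective F G f \<longleftrightarrow> schematic F G f \<and>
     (\<forall>A. cring A \<longrightarrow> (\<forall>y\<in>pts G A.
        etale_surjective_on A (fibprod F f (Spec A) (yoneda G A y)) (\<lambda>R. snd)))"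

text \<open>An algebraic space \<open>\<pi> : X \<rightarrow> S\<close>: an etale sheaf with schematic diagonal and an etale atlas
  \<open>U \<rightarrow> X\<close> by a scheme \<open>U\<close>.  The type of the values of \<open>U\<close> is no restriction: every atlas can be
  refined to a disjoint union of affine schemes \<open>Spec A\<close>, indexed by a set of pairs \<open>(A, x)\<close>
  with \<open>x \<in> X(A)\<close>, and an \<open>R\<close>-point of that disjoint union is encoded by the family of maps
  \<open>a \<mapsto> e g(a)\<close>, \<open>A \<rightarrow> R\<close>, with \<open>e\<close> idempotent, which it defines.\<close>

definition algebraic_space ::
  "('u, 's) zfun \<Rightarrow> ('u, 'x) zfun \<Rightarrow> ('u, 'x, 's) nt \<Rightarrow> bool" where
  "algebraic_space S X \<pi> \<longleftrightarrow> etale_sheaf X \<and> \<pi> \<in> NT X S \<and>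
     schematic X (fibprod X \<pi> X \<pi>) (mkNT X (\<lambda>A x. (x, x))) \<and>
     (\<exists>(U :: ('u, 'u ring \<times> 'x \<Rightarrow> 'u \<Rightarrow> 'u) zfun) p. scheme U \<and> etale_surjective U X p)"


section \<open>Monoids, groups and actions over a base\<close>

text \<open>A multiplication is a morphism \<open>X \<times>\<^sub>S X \<rightarrow> X\<close> over \<open>S\<close>, a unit is a section \<open>S \<rightarrow> X\<close>.\<close>

definition fibre_monoid ::
  "('u, 'x) zfun \<Rightarrow> ('u, 'x, 's) nt \<Rightarrow> ('u, 'x \<times> 'x, 'x) nt \<Rightarrow> ('u, 's, 'x) nt \<Rightarrow>
   'u ring \<Rightarrow> 's \<Rightarrow> 'x monoid" where
  "fibre_monoid X \<pi> \<mu> e R s = \<lparr>carrier = {x \<in> pts X R. \<pi> R x = s},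
                                monoid.mult = (\<lambda>x y. \<mu> R (x, y)), one = e R s\<rparr>"

definition monoid_over ::
  "('u, 's) zfun \<Rightarrow> ('u, 'x) zfun \<Rightarrow> ('u, 'x, 's) nt \<Rightarrow> ('u, 'x \<times> 'x, 'x) nt \<Rightarrow>
   ('u, 's, 'x) nt \<Rightarrow> bool" where
  "monoid_over S X \<pi> \<mu> e \<longleftrightarrow>
     \<mu> \<in> over_hom (fibprod X \<pi> X \<pi>) (\<lambda>R. \<pi> R \<circ> fst) X \<pi> \<and>
     e \<in> over_hom S (idNT S) X \<pi> \<and>
     (\<forall>R. cring R \<longrightarrow> (\<forall>s\<in>pts S R. monoid (fibre_monoid X \<pi> \<mu> e R s)))"

definition group_over ::
  "('u, 's) zfun \<Rightarrow> ('u, 'x) zfun \<Rightarrow> ('u, 'x, 's) nt \<Rightarrow> ('u, 'x \<times> 'x, 'x) nt \<Rightarrow>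
   ('u, 's, 'x) nt \<Rightarrow> bool" where
  "group_over S X \<pi> \<mu> e \<longleftrightarrow> monoid_over S X \<pi> \<mu> e \<and>
     (\<exists>\<iota>\<in>over_hom X \<pi> X \<pi>. \<forall>R. cring R \<longrightarrow> (\<forall>x\<in>pts X R.
        \<mu> R (\<iota> R x, x) = e R (\<pi> R x) \<and> \<mu> R (x, \<iota> R x) = e R (\<pi> R x)))"

text \<open>Left action on \<open>(Y, \<rho>)\<close> of the monoid \<open>(G, \<gamma>)\<close> with multiplication \<open>\<mu>\<close> and unit \<open>e\<close>, over the
  base which is the common target of \<open>\<gamma>\<close> and \<open>\<rho>\<close>.\<close>

definition action_over ::
  "('u, 'g) zfun \<Rightarrow> ('u, 'g, 's) nt \<Rightarrow> ('u, 'g \<times> 'g, 'g) nt \<Rightarrow> ('u, 's, 'g) nt \<Rightarrow>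
   ('u, 'y) zfun \<Rightarrow> ('u, 'y, 's) nt \<Rightarrow> ('u, 'g \<times> 'y, 'y) nt \<Rightarrow> bool" where
  "action_over G \<gamma> \<mu> e Y \<rho> \<alpha> \<longleftrightarrow>
     \<alpha> \<in> over_hom (fibprod G \<gamma> Y \<rho>) (\<lambda>R. \<gamma> R \<circ> fst) Y \<rho> \<and>
     (\<forall>R. cring R \<longrightarrow> (\<forall>y\<in>pts Y R. \<alpha> R (e R (\<rho> R y), y) = y)) \<and>
     (\<forall>R. cring R \<longrightarrow> (\<forall>g\<in>pts G R. \<forall>g'\<in>pts G R. \<forall>y\<in>pts Y R. \<gamma> R g = \<rho> R y \<and> \<gamma> R g' = \<rho> R y \<longrightarrow>
        \<alpha> R (\<mu> R (g, g'), y) = \<alpha> R (g, \<alpha> R (g', y))))"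

definition equivariant_homs ::
  "('u, 'g) zfun \<Rightarrow> ('u, 'g, 's) nt \<Rightarrow>
   ('u, 'y) zfun \<Rightarrow> ('u, 'y, 's) nt \<Rightarrow> ('u, 'g \<times> 'y, 'y) nt \<Rightarrow>
   ('u, 'z) zfun \<Rightarrow> ('u, 'z, 's) nt \<Rightarrow> ('u, 'g \<times> 'z, 'z) nt \<Rightarrow> ('u, 'y, 'z) nt set" where
  "equivariant_homs G \<gamma> Y \<rho> \<alpha> Z \<sigma> \<beta> =
     {\<phi> \<in> over_hom Y \<rho> Z \<sigma>. \<forall>R. cring R \<longrightarrow>
        (\<forall>(g, y)\<in>pts (fibprod G \<gamma> Y \<rho>) R. \<phi> R (\<alpha> R (g, y)) = \<beta> R (g, \<phi> R y))}"

text \<open>For every point \<open>g \<in> G(R)\<close> over \<open>s \<in> S(R)\<close>: the induced endomorphism of the fibre of \<open>X\<close>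
  over \<open>s\<close> is a monoid endomorphism, resp. a group automorphism.  As \<open>R\<close> varies, this says that
  \<open>g\<close> acts by an endomorphism (automorphism) of the functor \<open>X \<times>\<^sub>S Spec R\<close>.\<close>

definition acts_by_monoid_endos ::
  "('u, 'g) zfun \<Rightarrow> ('u, 'g, 's) nt \<Rightarrow> ('u, 'x) zfun \<Rightarrow> ('u, 'x, 's) nt \<Rightarrow>
   ('u, 'x \<times> 'x, 'x) nt \<Rightarrow> ('u, 's, 'x) nt \<Rightarrow> ('u, 'g \<times> 'x, 'x) nt \<Rightarrow> bool" where
  "acts_by_monoid_endos G \<gamma> X \<pi> \<mu> e \<alpha> \<longleftrightarrow>
     (\<forall>R. cring R \<longrightarrow> (\<forall>g\<in>pts G R.
        (\<lambda>x. \<alpha> R (g, x)) \<in> hom (fibre_monoid X \<pi> \<mu> e R (\<gamma> R g)) (fibre_monoid X \<pi> \<mu> e R (\<gamma> R g)) \<and>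
        \<alpha> R (g, e R (\<gamma> R g)) = e R (\<gamma> R g)))"

definition acts_by_group_autos ::
  "('u, 'g) zfun \<Rightarrow> ('u, 'g, 's) nt \<Rightarrow> ('u, 'x) zfun \<Rightarrow> ('u, 'x, 's) nt \<Rightarrow>
   ('u, 'x \<times> 'x, 'x) nt \<Rightarrow> ('u, 's, 'x) nt \<Rightarrow> ('u, 'g \<times> 'x, 'x) nt \<Rightarrow> bool" where
  "acts_by_group_autos G \<gamma> X \<pi> \<mu> e \<alpha> \<longleftrightarrow>
     (\<forall>R. cring R \<longrightarrow> (\<forall>g\<in>pts G R.
        (\<lambda>x. \<alpha> R (g, x)) \<in> iso (fibre_monoid X \<pi> \<mu> e R (\<gamma> R g)) (fibre_monoid X \<pi> \<mu> e R (\<gamma> R g))))"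


section \<open>The diagonalizable monoid schemes \<open>A(N)\<close>\<close>

text \<open>The commutative monoid \<open>M\<close> is a type \<open>'m\<close> of class \<^class>\<open>comm_monoid_add\<close>.\<close>

definition is_submonoid :: "'m::comm_monoid_add set \<Rightarrow> bool" where
  "is_submonoid N \<longleftrightarrow> 0 \<in> N \<and> (\<forall>a\<in>N. \<forall>b\<in>N. a + b \<in> N)"

text \<open>\<open>\<int>[N]\<close>, as a subring of the convolution ring \<open>\<int>[M]\<close>; the element \<open>X\<^sup>k\<close> is
  \<open>Poly_Mapping.single k 1\<close>.\<close>

definition monoid_ring :: "'m::comm_monoid_add set \<Rightarrow> ('m \<Rightarrow>\<^sub>0 int) ring" where
  "monoid_ring N = \<lparr>carrier = {p. Poly_Mapping.keys p \<subseteq> N}, monoid.mult = (*), one = 1,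
                    zero = 0, add = (+)\<rparr>"

definition AA :: "'m::comm_monoid_add set \<Rightarrow> ('u, ('m \<Rightarrow>\<^sub>0 int) \<Rightarrow> 'u) zfun" where
  "AA N = Spec (monoid_ring N)"

text \<open>On \<open>R\<close>-points \<open>m : \<int>[M] \<rightarrow> R\<close> and \<open>n : \<int>[N] \<rightarrow> R\<close>, the map \<open>A(M) \<times> A(N) \<rightarrow> A(N)\<close> given by
  \<open>X\<^sup>k \<mapsto> X\<^sup>k \<otimes> X\<^sup>k\<close> yields the homomorphism \<open>\<int>[N] \<rightarrow> R\<close> with \<open>X\<^sup>k \<mapsto> m(X\<^sup>k) n(X\<^sup>k)\<close>.  For \<open>N = M\<close> this is
  the multiplication of \<open>A(M)\<close>.  The unit of \<open>A(M)\<close> is \<open>X\<^sup>k \<mapsto> 1\<close>.\<close>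

definition AA_mult ::
  "'m::comm_monoid_add set \<Rightarrow> 'u ring \<Rightarrow> (('m \<Rightarrow>\<^sub>0 int) \<Rightarrow> 'u) \<Rightarrow> (('m \<Rightarrow>\<^sub>0 int) \<Rightarrow> 'u) \<Rightarrow>
   ('m \<Rightarrow>\<^sub>0 int) \<Rightarrow> 'u" where
  "AA_mult N R m n = (\<lambda>p\<in>carrier (monoid_ring N). \<Oplus>\<^bsub>R\<^esub>k\<in>Poly_Mapping.keys p.
     [Poly_Mapping.lookup p k] \<cdot>\<^bsub>R\<^esub>
       (m (Poly_Mapping.single k 1) \<otimes>\<^bsub>R\<^esub> n (Poly_Mapping.single k 1)))"

definition AA_unit :: "'m::comm_monoid_add set \<Rightarrow> 'u ring \<Rightarrow> ('m \<Rightarrow>\<^sub>0 int) \<Rightarrow> 'u" where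
  "AA_unit N R = (\<lambda>p\<in>carrier (monoid_ring N). \<Oplus>\<^bsub>R\<^esub>k\<in>Poly_Mapping.keys p.
     [Poly_Mapping.lookup p k] \<cdot>\<^bsub>R\<^esub> \<one>\<^bsub>R\<^esub>)"

text \<open>\<open>A(N)\<^sub>T = A(N) \<times> T\<close>, with structure morphism the second projection; the monoid structure of
  \<open>A(M)\<^sub>T\<close>; and the action of \<open>A(M)\<^sub>T\<close> on \<open>A(N)\<^sub>T\<close> over \<open>T\<close>.\<close>

definition AA_base ::
  "'m::comm_monoid_add set \<Rightarrow> ('u, 't) zfun \<Rightarrow> ('u, (('m \<Rightarrow>\<^sub>0 int) \<Rightarrow> 'u) \<times> 't) zfun" where
  "AA_base N T = prodF (AA N) T"

definition AA_base_act ::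
  "'m::comm_monoid_add set \<Rightarrow>
   ('u, ((('m \<Rightarrow>\<^sub>0 int) \<Rightarrow> 'u) \<times> 't) \<times> ((('m \<Rightarrow>\<^sub>0 int) \<Rightarrow> 'u) \<times> 't), (('m \<Rightarrow>\<^sub>0 int) \<Rightarrow> 'u) \<times> 't) nt" where
  "AA_base_act N = (\<lambda>R ((m, t), (n, t')). (AA_mult N R m n, t'))"

definition AA_base_unit :: "('u, 't, (('m::comm_monoid_add \<Rightarrow>\<^sub>0 int) \<Rightarrow> 'u) \<times> 't) nt" where
  "AA_base_unit = (\<lambda>R t. (AA_unit UNIV R, t))"

definition AA_action ::
  "('u, 's) zfun \<Rightarrow> ('u, 'x) zfun \<Rightarrow> ('u, 'x, 's) nt \<Rightarrow>
   ('u, ((('m::comm_monoid_add \<Rightarrow>\<^sub>0 int) \<Rightarrow> 'u) \<times> 's) \<times> 'x, 'x) nt \<Rightarrow> bool" where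
  "AA_action S X \<pi> \<alpha> \<longleftrightarrow>
     action_over (AA_base UNIV S) (\<lambda>R. snd) (AA_base_act UNIV) AA_base_unit X \<pi> \<alpha>"


section \<open>The attractor\<close>

text \<open>The action of \<open>A(M)\<^sub>T\<close> on \<open>X\<^sub>T = X \<times>\<^sub>S T\<close> obtained from \<open>\<alpha>\<close> by base change along \<open>\<tau> : T \<rightarrow> S\<close>.\<close>

definition base_change_action ::
  "('u, 't, 's) nt \<Rightarrow> ('u, ((('m::comm_monoid_add \<Rightarrow>\<^sub>0 int) \<Rightarrow> 'u) \<times> 's) \<times> 'x, 'x) nt \<Rightarrow>
   ('u, ((('m \<Rightarrow>\<^sub>0 int) \<Rightarrow> 'u) \<times> 't) \<times> ('x \<times> 't), 'x \<times> 't) nt" where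
  "base_change_action \<tau> \<alpha> = (\<lambda>R ((m, t), (x, t')). (\<alpha> R ((m, \<tau> R t), x), t'))"

definition attractor ::
  "('u, 'x) zfun \<Rightarrow> ('u, 'x, 's) nt \<Rightarrow> ('u, ((('m::comm_monoid_add \<Rightarrow>\<^sub>0 int) \<Rightarrow> 'u) \<times> 's) \<times> 'x, 'x) nt \<Rightarrow>
   'm set \<Rightarrow> ('u, 't) zfun \<Rightarrow> ('u, 't, 's) nt \<Rightarrow>
   ('u, (('m \<Rightarrow>\<^sub>0 int) \<Rightarrow> 'u) \<times> 't, 'x \<times> 't) nt set" where
  "attractor X \<pi> \<alpha> N T \<tau> =
     equivariant_homs (AA_base UNIV T) (\<lambda>R. snd)
       (AA_base N T) (\<lambda>R. snd) (AA_base_act N)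
       (fibprod X \<pi> T \<tau>) (\<lambda>R. snd) (base_change_action \<tau> \<alpha>)"

text \<open>Functoriality: for \<open>f : T' \<rightarrow> T\<close> over \<open>S\<close>, the base change of \<open>\<phi> : A(N)\<^sub>T \<rightarrow> X\<^sub>T\<close>.\<close>

definition attractor_pullback ::
  "'m::comm_monoid_add set \<Rightarrow> ('u, 't) zfun \<Rightarrow> ('u, 't, 't) nt \<Rightarrow>
   ('u, (('m \<Rightarrow>\<^sub>0 int) \<Rightarrow> 'u) \<times> 't, 'x \<times> 't) nt \<Rightarrow> ('u, (('m \<Rightarrow>\<^sub>0 int) \<Rightarrow> 'u) \<times> 't, 'x \<times> 't) nt" where
  "attractor_pullback N T' f \<phi> =
     mkNT (AA_base N T') (\<lambda>R (n, t'). (fst (\<phi> R (n, f R t')), t'))"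

text \<open>The pointwise law on \<open>X\<^sup>N(T)\<close>, using the multiplication \<open>((x, t), (y, t)) \<mapsto> (x y, t)\<close> and the unit
  \<open>t \<mapsto> (e(\<tau>(t)), t)\<close> of \<open>X\<^sub>T\<close>.\<close>

definition attractor_monoid ::
  "('u, 'x) zfun \<Rightarrow> ('u, 'x, 's) nt \<Rightarrow> ('u, 'x \<times> 'x, 'x) nt \<Rightarrow> ('u, 's, 'x) nt \<Rightarrow>
   ('u, ((('m::comm_monoid_add \<Rightarrow>\<^sub>0 int) \<Rightarrow> 'u) \<times> 's) \<times> 'x, 'x) nt \<Rightarrow>
   'm set \<Rightarrow> ('u, 't) zfun \<Rightarrow> ('u, 't, 's) nt \<Rightarrow>
   ('u, (('m \<Rightarrow>\<^sub>0 int) \<Rightarrow> 'u) \<times> 't, 'x \<times> 't) nt monoid" where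
  "attractor_monoid X \<pi> \<mu> e \<alpha> N T \<tau> =
     \<lparr>carrier = attractor X \<pi> \<alpha> N T \<tau>,
      monoid.mult = (\<lambda>\<phi> \<psi>. mkNT (AA_base N T)
        (\<lambda>R p. (\<mu> R (fst (\<phi> R p), fst (\<psi> R p)), snd p))),
      one = mkNT (AA_base N T) (\<lambda>R p. (e R (\<tau> R (snd p)), snd p))\<rparr>"


section \<open>Monoid and group functors on \<open>S\<close>-schemes\<close>

text \<open>A contravariant functor from \<open>S\<close>-schemes \<open>(T, \<tau>)\<close> to monoids: \<open>F T \<tau>\<close> is its value, and
  \<open>r T' f\<close> is the transition map of a morphism \<open>f\<close> with source \<open>T'\<close>.\<close>

definition monoid_functor ::
  "('u, 's) zfun \<Rightarrow> (('u, 't) zfun \<Rightarrow> ('u, 't, 's) nt \<Rightarrow> 'z monoid) \<Rightarrow>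
   (('u, 't) zfun \<Rightarrow> ('u, 't, 't) nt \<Rightarrow> 'z \<Rightarrow> 'z) \<Rightarrow> bool" where
  "monoid_functor S F r \<longleftrightarrow>
     (\<forall>T \<tau>. scheme T \<and> \<tau> \<in> NT T S \<longrightarrow>
        monoid (F T \<tau>) \<and> (\<forall>\<phi>\<in>carrier (F T \<tau>). r T (idNT T) \<phi> = \<phi>)) \<and>
     (\<forall>T \<tau> T' \<tau>' f. scheme T \<and> \<tau> \<in> NT T S \<and> scheme T' \<and> \<tau>' \<in> NT T' S \<and>
        f \<in> over_hom T' \<tau>' T \<tau> \<longrightarrow>
        r T' f \<in> hom (F T \<tau>) (F T' \<tau>') \<and> r T' f \<one>\<^bsub>F T \<tau>\<^esub> = \<one>\<^bsub>F T' \<tau>'\<^esub>) \<and>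
     (\<forall>T \<tau> T' \<tau>' T'' \<tau>'' f f'. scheme T \<and> \<tau> \<in> NT T S \<and> scheme T' \<and> \<tau>' \<in> NT T' S \<and>
        scheme T'' \<and> \<tau>'' \<in> NT T'' S \<and> f \<in> over_hom T' \<tau>' T \<tau> \<and> f' \<in> over_hom T'' \<tau>'' T' \<tau>' \<longrightarrow>
        (\<forall>\<phi>\<in>carrier (F T \<tau>). r T'' (compNT T'' f f') \<phi> = r T'' f' (r T' f \<phi>)))"

definition group_functor ::
  "('u, 's) zfun \<Rightarrow> (('u, 't) zfun \<Rightarrow> ('u, 't, 's) nt \<Rightarrow> 'z monoid) \<Rightarrow>
   (('u, 't) zfun \<Rightarrow> ('u, 't, 't) nt \<Rightarrow> 'z \<Rightarrow> 'z) \<Rightarrow> bool" where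
  "group_functor S F r \<longleftrightarrow> monoid_functor S F r \<and>
     (\<forall>T \<tau>. scheme T \<and> \<tau> \<in> NT T S \<longrightarrow> group (F T \<tau>))"

end

theory Submission
  imports Defs
begin

text \<open>
  The product of two equivariant morphisms, the constant morphism at the unit and, for groups, the
  inverse of an equivariant morphism are again equivariant, because every point of \<open>A(M)\<close> acts on
  the fibres of \<open>X\<close> by monoid endomorphisms and these preserve inverses.  The monoid and group laws
  for \<open>X\<^sup>N(T)\<close> are then checked fibrewise on points, and base change is precomposition, hence
  compatible with the pointwise law.  Evaluating such a morphism at a translated point requires that
  the action of \<open>A(M)\<close> preserves \<open>A(N)\<close>, i.e. that \<open>X\<^sup>k \<mapsto> m(X\<^sup>k) n(X\<^sup>k)\<close> extends to a ring
  homomorphism \<open>\<int>[N] \<rightarrow> R\<close>.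
\<close>

section \<open>Additive maps from a monoid ring given by their values on monomials\<close>

text \<open>The additive map sending the monomial \<open>X^k\<close> to \<open>c k\<close>.
  \<open>AA_mult N R m n\<close> is its restriction to \<open>\<int>[N]\<close> for the family
  \<open>c k = m(X^k) n(X^k)\<close>; a general family \<open>c\<close> isolates what makes that
  restriction a ring homomorphism.\<close>

definition lin_ext :: "('u, 'b) ring_scheme \<Rightarrow> ('m \<Rightarrow> 'u) \<Rightarrow> ('m \<Rightarrow>\<^sub>0 int) \<Rightarrow> 'u" where
  "lin_ext R c p = (\<Oplus>\<^bsub>R\<^esub>k\<in>Poly_Mapping.keys p. [Poly_Mapping.lookup p k] \<cdot>\<^bsub>R\<^esub> c k)"

context ring
begin

lemma lin_ext_closed:
  assumes "c \<in> N \<rightarrow> carrier R" "Poly_Mapping.keys p \<subseteq> N"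
  shows "lin_ext R c p \<in> carrier R"
  unfolding lin_ext_def using assms
  by (intro finsum_closed) (auto intro!: add.int_pow_closed)

lemma add_pow_int_zero: "[(0::int)] \<cdot> x = \<zero>"
  by (simp add: add_pow_def)

text \<open>Indices outside the support of \<open>p\<close> contribute zero multiples. This lets
  several elements be summed over one common index set.\<close>

lemma lin_ext_superset:
  assumes "c \<in> N \<rightarrow> carrier R" "finite K" "Poly_Mapping.keys p \<subseteq> K" "K \<subseteq> N"
  shows "lin_ext R c p = (\<Oplus>k\<in>K. [Poly_Mapping.lookup p k] \<cdot> c k)"
  unfolding lin_ext_def using assms
  by (intro add.finprod_mono_neutral_cong_left)
    (auto simp: in_keys_iff add_pow_int_zero intro!: add.int_pow_closed)

lemma lin_ext_add:
  assumes c: "c \<in> N \<rightarrow> carrier R" and pq: "Poly_Mapping.keys p \<subseteq> N" "Poly_Mapping.keys q \<subseteq> N"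
  shows "lin_ext R c (p + q) = lin_ext R c p \<oplus> lin_ext R c q"
proof -
  \<comment> \<open>Cancellation may make the support of \<open>p + q\<close> smaller than the
    union, which still serves as index set for all three sums.\<close>
  let ?K = "Poly_Mapping.keys p \<union> Poly_Mapping.keys q"
  have K: "?K \<subseteq> N" "finite ?K" "Poly_Mapping.keys (p + q) \<subseteq> ?K"
    using pq Poly_Mapping.keys_add[of p q] by auto
  have cK: "c k \<in> carrier R" if "k \<in> ?K" for k using that c K(1) by auto
  have "lin_ext R c (p + q) = (\<Oplus>k\<in>?K. [Poly_Mapping.lookup (p + q) k] \<cdot> c k)"
    using lin_ext_superset[OF c K(2,3,1)] .
  also have "\<dots> = (\<Oplus>k\<in>?K. [Poly_Mapping.lookup p k] \<cdot> c k \<oplus> [Poly_Mapping.lookup q k] \<cdot> c k)"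
    by (intro add.finprod_cong')
      (use cK in \<open>auto simp: lookup_add add.int_pow_mult intro!: add.int_pow_closed\<close>)
  also have "\<dots> = (\<Oplus>k\<in>?K. [Poly_Mapping.lookup p k] \<cdot> c k) \<oplus> (\<Oplus>k\<in>?K. [Poly_Mapping.lookup q k] \<cdot> c k)"
    by (intro finsum_addf) (use cK in \<open>auto intro!: add.int_pow_closed\<close>)
  also have "\<dots> = lin_ext R c p \<oplus> lin_ext R c q"
    using lin_ext_superset[OF c K(2) _ K(1), of p] lin_ext_superset[OF c K(2) _ K(1), of q] by simp
  finally show ?thesis .
qed

text \<open>Additivity applied to \<open>(p - q) + q\<close>. Differences matter because
  \<open>frag_induction\<close> builds elements from monomials by subtraction.\<close>

lemma lin_ext_diff:
  assumes c: "c \<in> N \<rightarrow> carrier R" and pq: "Poly_Mapping.keys p \<subseteq> N" "Poly_Mapping.keys q \<subseteq> N"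
  shows "lin_ext R c (p - q) = lin_ext R c p \<ominus> lin_ext R c q"
proof -
  have d: "Poly_Mapping.keys (p - q) \<subseteq> N"
    using keys_diff[of p q] pq by auto
  note cl = lin_ext_closed[OF c d] lin_ext_closed[OF c pq(1)] lin_ext_closed[OF c pq(2)]
  have "lin_ext R c p = lin_ext R c (p - q) \<oplus> lin_ext R c q"
    using lin_ext_add[OF c d pq(2)] by simp
  then show ?thesis using cl by (simp add: minus_eq a_assoc r_neg)
qed

lemma lin_ext_zero: "lin_ext R c 0 = \<zero>"
  by (simp add: lin_ext_def)

lemma lin_ext_single:
  assumes "c k \<in> carrier R"
  shows "lin_ext R c (Poly_Mapping.single k 1) = c k"
  using assms by (simp add: lin_ext_def)

text \<open>Both sides are additive in \<open>p\<close> and in \<open>q\<close>, and for two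
  monomials the claim is \<open>c_add\<close>. Hence one induction for each factor: first on the
  right with a monomial on the left, then on the left.\<close>

lemma lin_ext_mult:
  fixes N :: "'m::comm_monoid_add set"
  assumes N: "is_submonoid N" and c: "c \<in> N \<rightarrow> carrier R"
    and c_add: "\<And>k l. k \<in> N \<Longrightarrow> l \<in> N \<Longrightarrow> c (k + l) = c k \<otimes> c l"
    and p: "Poly_Mapping.keys p \<subseteq> N" and q: "Poly_Mapping.keys q \<subseteq> N"
  shows "lin_ext R c (p * q) = lin_ext R c p \<otimes> lin_ext R c q"
proof -
  have keysN: "Poly_Mapping.keys (a * b) \<subseteq> N"
    if "Poly_Mapping.keys a \<subseteq> N" "Poly_Mapping.keys b \<subseteq> N" for a b :: "'m \<Rightarrow>\<^sub>0 int"
    using keys_mult[of a b] that N unfolding is_submonoid_def by blast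
  have cc: "c k \<in> carrier R" if "k \<in> N" for k using c that by auto
  have single: "lin_ext R c (frag_of k * b) = c k \<otimes> lin_ext R c b"
    if k: "k \<in> N" and b: "Poly_Mapping.keys b \<subseteq> N" for k b
  proof -
    \<comment> \<open>The difference case of \<open>frag_induction\<close> provides only the
      induction predicate for \<open>a\<close> and \<open>b\<close>, so containment of the keys in
      \<open>N\<close> is made part of that predicate.\<close>
    have "Poly_Mapping.keys b \<subseteq> N \<and> lin_ext R c (frag_of k * b) = c k \<otimes> lin_ext R c b"
      using b
    proof (induction b rule: frag_induction)
      case zero
      show ?case using cc k by (simp add: lin_ext_zero)
    next
      case (one l)
      then have "k + l \<in> N" using k N by (auto simp: is_submonoid_def)
      then show ?case using one k cc by (simp add: mult_single lin_ext_single c_add)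
    next
      case (diff a b)
      then have ab: "Poly_Mapping.keys a \<subseteq> N" "Poly_Mapping.keys b \<subseteq> N" by auto
      then have kab: "Poly_Mapping.keys (frag_of k * a) \<subseteq> N" "Poly_Mapping.keys (frag_of k * b) \<subseteq> N"
        using k by (simp_all add: keysN)
      show ?case
        using diff keys_diff[of a b] lin_ext_diff[OF c kab] lin_ext_diff[OF c ab] cc[OF k]
          lin_ext_closed[OF c ab(1)] lin_ext_closed[OF c ab(2)]
        by (auto simp: right_diff_distrib minus_eq r_distr r_minus)
    qed
    then show ?thesis by simp
  qed
  have "Poly_Mapping.keys p \<subseteq> N \<and> lin_ext R c (p * q) = lin_ext R c p \<otimes> lin_ext R c q"
    using p
  proof (induction p rule: frag_induction)
    case zero
    show ?case using lin_ext_closed[OF c q] by (simp add: lin_ext_zero)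
  next
    case (one k)
    then show ?case using single[OF _ q] cc by (simp add: lin_ext_single)
  next
    case (diff a b)
    then have ab: "Poly_Mapping.keys a \<subseteq> N" "Poly_Mapping.keys b \<subseteq> N" by auto
    show ?case
      using diff keys_diff[of a b] lin_ext_diff[OF c keysN[OF ab(1) q] keysN[OF ab(2) q]]
        lin_ext_diff[OF c ab] lin_ext_closed[OF c ab(1)] lin_ext_closed[OF c ab(2)]
        lin_ext_closed[OF c q]
      by (auto simp: left_diff_distrib minus_eq l_distr l_minus)
  qed
  then show ?thesis by simp
qed

end

section \<open>Homomorphisms out of \<open>monoid_ring N\<close> and translation by points of
  A(M)\<close>

text \<open>An additive map on \<open>\<int>[N]\<close> is multiplicative once it is so on
  monomials. The family \<open>m(X^k) n(X^k)\<close> is multiplicative because both homomorphisms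
  are and the factors commute in \<open>R\<close>.\<close>

lemma AA_mult_in_rhom:
  fixes N :: "'m::comm_monoid_add set"
  assumes R: "cring R" and N: "is_submonoid N"
    and m: "m \<in> rhom (monoid_ring UNIV) R" and n: "n \<in> rhom (monoid_ring N) R"
  shows "AA_mult N R m n \<in> rhom (monoid_ring N) R"
proof -
  interpret cring R by fact
  let ?X = "\<lambda>k :: 'm. Poly_Mapping.single k (1 :: int)"
  define c where "c k = m (?X k) \<otimes>\<^bsub>R\<^esub> n (?X k)" for k
  have hm: "m \<in> ring_hom (monoid_ring UNIV) R" and hn: "n \<in> ring_hom (monoid_ring N) R"
    using m n by (auto simp: rhom_def)
  have cl: "m (?X k) \<in> carrier R" "k \<in> N \<Longrightarrow> n (?X k) \<in> carrier R" for k
    using ring_hom_closed[OF hm, of "?X k"] ring_hom_closed[OF hn, of "?X k"]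
    by (auto simp: monoid_ring_def)
  have c: "c \<in> N \<rightarrow> carrier R" using cl by (auto simp: c_def)
  have X_add: "?X (k + l) = ?X k * ?X l" for k l by (simp add: mult_single)
  have c_add: "c (k + l) = c k \<otimes>\<^bsub>R\<^esub> c l" if "k \<in> N" "l \<in> N" for k l
    using ring_hom_mult[OF hm, of "?X k" "?X l"] ring_hom_mult[OF hn, of "?X k" "?X l"] that cl
    by (simp add: monoid_ring_def c_def X_add m_ac)
  have "0 \<in> N" using N by (simp add: is_submonoid_def)
  have one: "lin_ext R c 1 = \<one>\<^bsub>R\<^esub>"
  proof -
    \<comment> \<open>The unit of the monoid ring is the monomial \<open>X^0\<close>.\<close>
    have "c 0 = \<one>\<^bsub>R\<^esub>"
      using ring_hom_one[OF hm] ring_hom_one[OF hn] by (simp add: monoid_ring_def c_def)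
    then show ?thesis using lin_ext_single[of c 0] by simp
  qed
  have "AA_mult N R m n = restrict (lin_ext R c) (carrier (monoid_ring N))"
    by (simp add: AA_mult_def lin_ext_def[abs_def] c_def)
  moreover have "restrict (lin_ext R c) (carrier (monoid_ring N)) \<in> ring_hom (monoid_ring N) R"
  proof (rule ring_hom_memI)
    fix p q assume "p \<in> carrier (monoid_ring N)" "q \<in> carrier (monoid_ring N)"
    then have k: "Poly_Mapping.keys p \<subseteq> N" "Poly_Mapping.keys q \<subseteq> N"
      by (auto simp: monoid_ring_def)
    moreover have "Poly_Mapping.keys (p * q) \<subseteq> N"
      using keys_mult[of p q] k N unfolding is_submonoid_def by blast
    moreover have "Poly_Mapping.keys (p + q) \<subseteq> N"
      using Poly_Mapping.keys_add[of p q] k by blast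
    ultimately show
      "restrict (lin_ext R c) (carrier (monoid_ring N)) p \<in> carrier R"
      "restrict (lin_ext R c) (carrier (monoid_ring N)) (p \<otimes>\<^bsub>monoid_ring N\<^esub> q) =
        restrict (lin_ext R c) (carrier (monoid_ring N)) p \<otimes>\<^bsub>R\<^esub>
        restrict (lin_ext R c) (carrier (monoid_ring N)) q"
      "restrict (lin_ext R c) (carrier (monoid_ring N)) (p \<oplus>\<^bsub>monoid_ring N\<^esub> q) =
        restrict (lin_ext R c) (carrier (monoid_ring N)) p \<oplus>\<^bsub>R\<^esub>
        restrict (lin_ext R c) (carrier (monoid_ring N)) q"
      using lin_ext_closed[OF c k(1)] lin_ext_mult[OF N c c_add k] lin_ext_add[OF c k]
      by (simp_all add: monoid_ring_def)
  next
    show "restrict (lin_ext R c) (carrier (monoid_ring N)) \<one>\<^bsub>monoid_ring N\<^esub> = \<one>\<^bsub>R\<^esub>"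
      using one \<open>0 \<in> N\<close> by (simp add: monoid_ring_def)
  qed
  ultimately show ?thesis by (simp add: rhom_def)
qed

text \<open>\<open>compose\<close> is undefined off \<open>carrier A\<close>; closure of this
  carrier under the ring operations lets the homomorphism laws pass to the composite.\<close>

lemma rhom_compose:
  assumes A: "ring A" and "h \<in> rhom A B" "k \<in> rhom B C"
  shows "compose (carrier A) k h \<in> rhom A C"
proof -
  interpret ring A by fact
  show ?thesis
    using assms by (auto simp: rhom_def ring_hom_def compose_def Pi_iff)
qed

text \<open>Through \<open>rhom_compose\<close> this makes change of rings preserve the points of
  A(N). Supports of sums and products stay in \<open>N\<close>.\<close>

lemma ring_monoid_ring:
  assumes "is_submonoid N"
  shows "ring (monoid_ring N)"
proof (rule ringI)
  show "abelian_group (monoid_ring N)"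
  proof (rule abelian_groupI)
    fix p assume "p \<in> carrier (monoid_ring N)"
    then show "\<exists>q\<in>carrier (monoid_ring N). q \<oplus>\<^bsub>monoid_ring N\<^esub> p = \<zero>\<^bsub>monoid_ring N\<^esub>"
      by (intro bexI[of _ "- p"]) (auto simp: monoid_ring_def)
  qed (auto simp: monoid_ring_def add_ac dest!: Poly_Mapping.keys_add[THEN subsetD])
  show "monoid (monoid_ring N)"
    using assms
    by (intro monoidI)
      (auto simp: monoid_ring_def is_submonoid_def mult_ac dest!: keys_mult[THEN subsetD])
qed (auto simp: monoid_ring_def distrib_left distrib_right)

section \<open>Points of \<open>AA_base N T\<close> and natural transformations\<close>

lemma pts_AA_base: "pts (AA_base N T) R = rhom (monoid_ring N) R \<times> pts T R"
  by (simp add: AA_base_def AA_def prodF_def Spec_def)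

lemma tr_AA_base:
  "tr (AA_base N T) A B h (n, t) = (compose (carrier (monoid_ring N)) h n, tr T A B h t)"
  by (simp add: AA_base_def AA_def prodF_def Spec_def)

lemma tr_AA_base_closed:
  assumes "is_zfun T" "is_submonoid N" "cring A" "cring B" "h \<in> rhom A B" "p \<in> pts (AA_base N T) A"
  shows "tr (AA_base N T) A B h p \<in> pts (AA_base N T) B"
  using assms by (cases p) (auto simp: pts_AA_base tr_AA_base is_zfun_def intro: rhom_compose ring_monoid_ring)

lemma scheme_zfun: "scheme T \<Longrightarrow> is_zfun T"
  by (simp add: scheme_def zariski_sheaf_def)

lemma NT_closed: "\<eta> \<in> NT F G \<Longrightarrow> cring R \<Longrightarrow> x \<in> pts F R \<Longrightarrow> \<eta> R x \<in> pts G R"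
  by (auto simp: NT_def PiE_iff)

lemma NT_natural:
  "\<eta> \<in> NT F G \<Longrightarrow> cring A \<Longrightarrow> cring B \<Longrightarrow> h \<in> rhom A B \<Longrightarrow> x \<in> pts F A \<Longrightarrow>
    \<eta> B (tr F A B h x) = tr G A B h (\<eta> A x)"
  by (auto simp: NT_def)

lemma mkNT_apply [simp]: "cring R \<Longrightarrow> x \<in> pts F R \<Longrightarrow> mkNT F \<eta> R x = \<eta> R x"
  by (simp add: mkNT_def)

lemma mkNT_eqI:
  "(\<And>R x. cring R \<Longrightarrow> x \<in> pts F R \<Longrightarrow> \<eta> R x = \<theta> R x) \<Longrightarrow> mkNT F \<eta> = mkNT F \<theta>"
  by (fastforce simp: mkNT_def restrict_def)

text \<open>Members of \<open>NT\<close> are extensional both in the ring and in the point, so they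
  have the same default values as \<open>mkNT\<close>.\<close>

lemma mkNT_NT: "\<eta> \<in> NT F G \<Longrightarrow> mkNT F \<eta> = \<eta>"
  by (auto simp: NT_def mkNT_def PiE_iff intro!: extensionalityI ext)
    (auto simp: extensional_def restrict_def)

section \<open>Equivariant morphisms described by their first components\<close>

text \<open>A \<open>T\<close>-morphism \<open>A(N)\<^sub>T \<rightarrow> X\<^sub>T\<close> is determined by its first component \<open>A(N)\<^sub>T \<rightarrow> X\<close>; this is the
  condition on that component for the morphism to lie in the attractor.\<close>

definition attracted ::
  "('u, 'x) zfun \<Rightarrow> ('u, 'x, 's) nt \<Rightarrow> ('u, ((('m::comm_monoid_add \<Rightarrow>\<^sub>0 int) \<Rightarrow> 'u) \<times> 's) \<times> 'x, 'x) nt \<Rightarrow>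
   'm set \<Rightarrow> ('u, 't) zfun \<Rightarrow> ('u, 't, 's) nt \<Rightarrow> ('u, (('m \<Rightarrow>\<^sub>0 int) \<Rightarrow> 'u) \<times> 't, 'x) nt \<Rightarrow> bool" where
  "attracted X \<pi> \<alpha> N T \<tau> F \<longleftrightarrow>
     (\<forall>R n t. cring R \<and> n \<in> rhom (monoid_ring N) R \<and> t \<in> pts T R \<longrightarrow>
        F R (n, t) \<in> pts X R \<and> \<pi> R (F R (n, t)) = \<tau> R t \<and>
        (\<forall>m\<in>rhom (monoid_ring UNIV) R.
           F R (AA_mult N R m n, t) = \<alpha> R ((m, \<tau> R t), F R (n, t))) \<and>
        (\<forall>B h. cring B \<and> h \<in> rhom R B \<longrightarrow>
           F B (compose (carrier (monoid_ring N)) h n, tr T R B h t) = tr X R B h (F R (n, t))))"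

text \<open>A morphism over \<open>T\<close> keeps the second component. The resulting normal form
  allows comparison at points by \<open>mkNT_eqI\<close>.\<close>

lemma attractor_eq_mkNT:
  assumes "\<phi> \<in> attractor X \<pi> \<alpha> N T \<tau>"
  shows "\<phi> = mkNT (AA_base N T) (\<lambda>R p. (fst (\<phi> R p), snd p))"
proof -
  have \<phi>: "\<phi> \<in> NT (AA_base N T) (fibprod X \<pi> T \<tau>)"
    and s: "\<And>R p. cring R \<Longrightarrow> p \<in> pts (AA_base N T) R \<Longrightarrow> snd (\<phi> R p) = snd p"
    using assms by (auto simp: attractor_def equivariant_homs_def over_hom_def)
  have "\<phi> = mkNT (AA_base N T) \<phi>" using mkNT_NT[OF \<phi>] by simp
  also have "\<dots> = mkNT (AA_base N T) (\<lambda>R p. (fst (\<phi> R p), snd p))"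
    by (rule mkNT_eqI) (simp add: s prod_eq_iff)
  finally show ?thesis .
qed

lemma attractor_attracted:
  assumes "\<phi> \<in> attractor X \<pi> \<alpha> N T \<tau>"
  shows "attracted X \<pi> \<alpha> N T \<tau> (\<lambda>R p. fst (\<phi> R p))"
proof -
  have \<phi>: "\<phi> \<in> NT (AA_base N T) (fibprod X \<pi> T \<tau>)"
    and s: "\<And>R n t. cring R \<Longrightarrow> n \<in> rhom (monoid_ring N) R \<Longrightarrow> t \<in> pts T R \<Longrightarrow> snd (\<phi> R (n, t)) = t"
    \<comment> \<open>A point of the fibre product over \<open>T\<close> has one and the same
      \<open>t\<close> in both factors.\<close>
    and eq: "\<And>R m n t. cring R \<Longrightarrow> m \<in> rhom (monoid_ring UNIV) R \<Longrightarrow>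
        n \<in> rhom (monoid_ring N) R \<Longrightarrow> t \<in> pts T R \<Longrightarrow>
        \<phi> R (AA_base_act N R ((m, t), (n, t))) = base_change_action \<tau> \<alpha> R ((m, t), \<phi> R (n, t))"
    using assms
    by (auto simp: attractor_def equivariant_homs_def over_hom_def fibprod_def pts_AA_base)
  show ?thesis
    unfolding attracted_def
  proof (intro allI impI, elim conjE)
    fix R n t assume R: "cring R" and n: "n \<in> rhom (monoid_ring N) R" and t: "t \<in> pts T R"
    have p: "(n, t) \<in> pts (AA_base N T) R" using n t by (simp add: pts_AA_base)
    obtain x where x: "\<phi> R (n, t) = (x, t)" using s[OF R n t] by (metis prod.collapse)
    have "(x, t) \<in> pts (fibprod X \<pi> T \<tau>) R" using NT_closed[OF \<phi> R p] x by simp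
    then have "x \<in> pts X R" "\<pi> R x = \<tau> R t" by (auto simp: fibprod_def)
    moreover have "fst (\<phi> R (AA_mult N R m n, t)) = \<alpha> R ((m, \<tau> R t), x)"
      if "m \<in> rhom (monoid_ring UNIV) R" for m
      using eq[OF R that n t] x by (simp add: AA_base_act_def base_change_action_def)
    moreover have "fst (\<phi> B (compose (carrier (monoid_ring N)) h n, tr T R B h t)) = tr X R B h x"
      if "cring B" "h \<in> rhom R B" for B h
      using NT_natural[OF \<phi> R that p] x by (simp add: tr_AA_base fibprod_def)
    ultimately show "fst (\<phi> R (n, t)) \<in> pts X R \<and> \<pi> R (fst (\<phi> R (n, t))) = \<tau> R t \<and>
        (\<forall>m\<in>rhom (monoid_ring UNIV) R.
           fst (\<phi> R (AA_mult N R m n, t)) = \<alpha> R ((m, \<tau> R t), fst (\<phi> R (n, t)))) \<and>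
        (\<forall>B h. cring B \<and> h \<in> rhom R B \<longrightarrow>
           fst (\<phi> B (compose (carrier (monoid_ring N)) h n, tr T R B h t)) =
           tr X R B h (fst (\<phi> R (n, t))))"
      using x by simp
  qed
qed

text \<open>Converse of \<open>attractor_attracted\<close>. The hypotheses on \<open>T\<close> and
  \<open>N\<close> keep transported and translated points inside \<open>AA_base N T\<close>, where
  \<open>mkNT\<close> does not return its default value.\<close>

lemma mkNT_in_attractor:
  assumes T: "is_zfun T" and N: "is_submonoid N" and F: "attracted X \<pi> \<alpha> N T \<tau> F"
  shows "mkNT (AA_base N T) (\<lambda>R p. (F R p, snd p)) \<in> attractor X \<pi> \<alpha> N T \<tau>"
proof -
  let ?\<phi> = "mkNT (AA_base N T) (\<lambda>R p. (F R p, snd p))"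
  have F1: "(F R p, snd p) \<in> pts (fibprod X \<pi> T \<tau>) R"
    if "cring R" "p \<in> pts (AA_base N T) R" for R p
    using F that by (cases p) (auto simp: attracted_def pts_AA_base fibprod_def)
  have "?\<phi> \<in> NT (AA_base N T) (fibprod X \<pi> T \<tau>)"
    unfolding NT_def
  proof (intro CollectI conjI allI impI ballI, goal_cases)
    case 1
    show ?case using F1 by (auto simp: mkNT_def)
  next
    case (2 A B h p)
    then show ?case
      using F tr_AA_base_closed[OF T N, of A B h p]
      by (cases p) (auto simp: attracted_def pts_AA_base tr_AA_base fibprod_def)
  qed
  moreover have "?\<phi> R (AA_base_act N R ((m, t), (n, t))) = base_change_action \<tau> \<alpha> R ((m, t), ?\<phi> R (n, t))"
    if "cring R" "m \<in> rhom (monoid_ring UNIV) R" "n \<in> rhom (monoid_ring N) R" "t \<in> pts T R"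
    for R m n t
    using F that AA_mult_in_rhom[OF that(1) N that(2,3)]
    by (simp add: attracted_def pts_AA_base AA_base_act_def base_change_action_def)
  ultimately show ?thesis
    by (auto simp: attractor_def equivariant_homs_def over_hom_def fibprod_def pts_AA_base)
qed

section \<open>Stability under base change, unit, product and inverse\<close>

lemma attracted_pullback:
  assumes "attracted X \<pi> \<alpha> N T \<tau> F" "f \<in> over_hom T' \<tau>' T \<tau>"
  shows "attracted X \<pi> \<alpha> N T' \<tau>' (\<lambda>R p. F R (fst p, f R (snd p)))"
proof -
  have f: "f \<in> NT T' T" "\<And>R t. cring R \<Longrightarrow> t \<in> pts T' R \<Longrightarrow> \<tau> R (f R t) = \<tau>' R t"
    using assms(2) by (auto simp: over_hom_def)
  show ?thesis
    \<comment> \<open>Replacing \<open>\<tau>'\<close> by the composite of \<open>\<tau>\<close>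
      with \<open>f\<close> reduces each clause to that for \<open>F\<close> at
      \<open>f R t\<close>; naturality of \<open>f\<close> handles change of rings.\<close>
    using assms(1) unfolding attracted_def
    by (simp add: f(2)[symmetric] NT_closed[OF f(1)] NT_natural[OF f(1)])
qed

text \<open>Brings base change into the shape treated by \<open>mkNT_in_attractor\<close>, with
  projections in place of pattern matching.\<close>

lemma attractor_pullback_eq:
  "attractor_pullback N T' f \<phi> =
    mkNT (AA_base N T') (\<lambda>R p. (fst (\<phi> R (fst p, f R (snd p))), snd p))"
  by (auto simp: attractor_pullback_def intro!: mkNT_eqI)

text \<open>Equivariance holds because each point of A(M) fixes the unit of its fibre. This is a
  separate clause of \<open>acts_by_monoid_endos\<close>, since members of \<open>hom\<close> need
  only respect products.\<close>

lemma attracted_unit: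
  assumes e: "e \<in> over_hom S (idNT S) X \<pi>" and \<tau>: "\<tau> \<in> NT T S"
    and act: "acts_by_monoid_endos (AA_base UNIV S) (\<lambda>R. snd) X \<pi> \<mu> e \<alpha>"
  shows "attracted X \<pi> \<alpha> N T \<tau> (\<lambda>R p. e R (\<tau> R (snd p)))"
proof -
  have e': "e \<in> NT S X" "\<And>R s. cring R \<Longrightarrow> s \<in> pts S R \<Longrightarrow> \<pi> R (e R s) = s"
    using e by (auto simp: over_hom_def idNT_def)
  show ?thesis
    using act
    by (simp add: attracted_def NT_closed[OF \<tau>] NT_natural[OF \<tau>] NT_closed[OF e'(1)]
        NT_natural[OF e'(1)] e'(2) acts_by_monoid_endos_def pts_AA_base)
qed

text \<open>At a given point \<open>p\<close> the values of \<open>F\<close> and \<open>G\<close>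
  lie over the same point of \<open>S\<close>, so their product is defined; equivariance is then
  multiplicativity of the action on that fibre.\<close>

lemma attracted_mult:
  assumes \<mu>: "\<mu> \<in> over_hom (fibprod X \<pi> X \<pi>) (\<lambda>R. \<pi> R \<circ> fst) X \<pi>" and \<tau>: "\<tau> \<in> NT T S"
    and act: "acts_by_monoid_endos (AA_base UNIV S) (\<lambda>R. snd) X \<pi> \<mu> e \<alpha>"
    and F: "attracted X \<pi> \<alpha> N T \<tau> F" and G: "attracted X \<pi> \<alpha> N T \<tau> G"
  shows "attracted X \<pi> \<alpha> N T \<tau> (\<lambda>R p. \<mu> R (F R p, G R p))"
proof -
  have \<mu>': "\<mu> \<in> NT (fibprod X \<pi> X \<pi>) X"
    "\<And>R x y. cring R \<Longrightarrow> x \<in> pts X R \<Longrightarrow> y \<in> pts X R \<Longrightarrow> \<pi> R x = \<pi> R y \<Longrightarrow> \<pi> R (\<mu> R (x, y)) = \<pi> R x"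
    using \<mu> by (auto simp: over_hom_def fibprod_def)
  have cl: "\<mu> R (x, y) \<in> pts X R"
    if "cring R" "x \<in> pts X R" "y \<in> pts X R" "\<pi> R x = \<pi> R y" for R x y
    using NT_closed[OF \<mu>'(1), of R "(x, y)"] that by (simp add: fibprod_def)
  have nat: "\<mu> B (tr X R B h x, tr X R B h y) = tr X R B h (\<mu> R (x, y))"
    if "cring R" "cring B" "h \<in> rhom R B" "x \<in> pts X R" "y \<in> pts X R" "\<pi> R x = \<pi> R y" for R B h x y
    using NT_natural[OF \<mu>'(1), of R B h "(x, y)"] that by (simp add: fibprod_def)
  have act': "\<alpha> R ((m, s), \<mu> R (x, y)) = \<mu> R (\<alpha> R ((m, s), x), \<alpha> R ((m, s), y))"
    if "cring R" "m \<in> rhom (monoid_ring UNIV) R" "s \<in> pts S R" "x \<in> pts X R" "y \<in> pts X R"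
      "\<pi> R x = s" "\<pi> R y = s" for R m s x y
    using act that by (auto simp: acts_by_monoid_endos_def pts_AA_base hom_def fibre_monoid_def)
  show ?thesis
    using F G
    by (simp add: attracted_def \<mu>'(2) cl nat act' NT_closed[OF \<tau>])
qed

text \<open>Equivariance comes down to inversion commuting with the action. This is a premise here
  and is derived from the group laws in \<open>group_attractor_monoid\<close>.\<close>

lemma attracted_inverse:
  assumes \<iota>: "\<iota> \<in> over_hom X \<pi> X \<pi>" and \<tau>: "\<tau> \<in> NT T S"
    and comm: "\<And>R m s x. cring R \<Longrightarrow> m \<in> rhom (monoid_ring UNIV) R \<Longrightarrow> s \<in> pts S R \<Longrightarrow>
      x \<in> pts X R \<Longrightarrow> \<pi> R x = s \<Longrightarrow> \<iota> R (\<alpha> R ((m, s), x)) = \<alpha> R ((m, s), \<iota> R x)"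
    and F: "attracted X \<pi> \<alpha> N T \<tau> F"
  shows "attracted X \<pi> \<alpha> N T \<tau> (\<lambda>R p. \<iota> R (F R p))"
proof -
  have \<iota>': "\<iota> \<in> NT X X" "\<And>R x. cring R \<Longrightarrow> x \<in> pts X R \<Longrightarrow> \<pi> R (\<iota> R x) = \<pi> R x"
    using \<iota> by (auto simp: over_hom_def)
  show ?thesis
    using F
    by (simp add: attracted_def \<iota>'(2) NT_closed[OF \<iota>'(1)] NT_natural[OF \<iota>'(1)] comm NT_closed[OF \<tau>])
qed

section \<open>The monoid law on the attractor\<close>

text \<open>All attracted maps take values at \<open>p\<close> in one and the same fibre, where the
  laws of \<open>fibre_monoid\<close> can be applied.\<close>

lemma attracted_point:
  assumes "attracted X \<pi> \<alpha> N T \<tau> F" "cring R" "p \<in> pts (AA_base N T) R"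
  shows "F R p \<in> carrier (fibre_monoid X \<pi> \<mu> e R (\<tau> R (snd p)))"
  using assms by (cases p) (auto simp: attracted_def pts_AA_base fibre_monoid_def)

lemma attractor_monoid_monoid:
  assumes T: "is_zfun T" and \<tau>: "\<tau> \<in> NT T S" and N: "is_submonoid N"
    and X: "monoid_over S X \<pi> \<mu> e"
    and act: "acts_by_monoid_endos (AA_base UNIV S) (\<lambda>R. snd) X \<pi> \<mu> e \<alpha>"
  shows "monoid (attractor_monoid X \<pi> \<mu> e \<alpha> N T \<tau>)" (is "monoid ?A")
proof -
  have \<mu>: "\<mu> \<in> over_hom (fibprod X \<pi> X \<pi>) (\<lambda>R. \<pi> R \<circ> fst) X \<pi>"
    and e: "e \<in> over_hom S (idNT S) X \<pi>"
    and fib: "\<And>R s. cring R \<Longrightarrow> s \<in> pts S R \<Longrightarrow> monoid (fibre_monoid X \<pi> \<mu> e R s)"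
    using X by (auto simp: monoid_over_def)
  have M: "monoid (fibre_monoid X \<pi> \<mu> e R (\<tau> R (snd p)))"
    if "cring R" "p \<in> pts (AA_base N T) R" for R p
    using that by (intro fib NT_closed[OF \<tau>]) (auto simp: pts_AA_base)
  show ?thesis
  proof (rule monoidI)
    show "\<one>\<^bsub>?A\<^esub> \<in> carrier ?A"
      using mkNT_in_attractor[OF T N attracted_unit[OF e \<tau> act]]
      by (simp add: attractor_monoid_def)
  next
    fix \<phi> \<psi> assume "\<phi> \<in> carrier ?A" "\<psi> \<in> carrier ?A"
    then show "\<phi> \<otimes>\<^bsub>?A\<^esub> \<psi> \<in> carrier ?A"
      using mkNT_in_attractor[OF T N attracted_mult[OF \<mu> \<tau> act
            attractor_attracted[of \<phi>] attractor_attracted[of \<psi>]]]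
      by (simp add: attractor_monoid_def)
  next
    fix \<phi> \<psi> \<chi> assume "\<phi> \<in> carrier ?A" "\<psi> \<in> carrier ?A" "\<chi> \<in> carrier ?A"
    then have "\<phi> \<in> attractor X \<pi> \<alpha> N T \<tau>" "\<psi> \<in> attractor X \<pi> \<alpha> N T \<tau>" "\<chi> \<in> attractor X \<pi> \<alpha> N T \<tau>"
      by (simp_all add: attractor_monoid_def)
    note a = this[THEN attractor_attracted, THEN attracted_point[where \<mu> = \<mu> and e = e]]
    have "\<mu> R (\<mu> R (fst (\<phi> R p), fst (\<psi> R p)), fst (\<chi> R p)) =
        \<mu> R (fst (\<phi> R p), \<mu> R (fst (\<psi> R p), fst (\<chi> R p)))"
      if "cring R" "p \<in> pts (AA_base N T) R" for R p
      using monoid.m_assoc[OF M[OF that] a(1)[OF that] a(2)[OF that] a(3)[OF that]]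
      by (simp add: fibre_monoid_def)
    then show "\<phi> \<otimes>\<^bsub>?A\<^esub> \<psi> \<otimes>\<^bsub>?A\<^esub> \<chi> = \<phi> \<otimes>\<^bsub>?A\<^esub> (\<psi> \<otimes>\<^bsub>?A\<^esub> \<chi>)"
      by (auto simp: attractor_monoid_def intro!: mkNT_eqI)
  next
    fix \<phi> assume "\<phi> \<in> carrier ?A"
    then have \<phi>: "\<phi> \<in> attractor X \<pi> \<alpha> N T \<tau>" by (simp add: attractor_monoid_def)
    note a = attracted_point[OF attractor_attracted[OF \<phi>], where \<mu> = \<mu> and e = e]
    have *: "\<mu> R (e R (\<tau> R (snd p)), fst (\<phi> R p)) = fst (\<phi> R p)"
      "\<mu> R (fst (\<phi> R p), e R (\<tau> R (snd p))) = fst (\<phi> R p)"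
      if "cring R" "p \<in> pts (AA_base N T) R" for R p
      using monoid.l_one[OF M[OF that] a[OF that]] monoid.r_one[OF M[OF that] a[OF that]]
      by (simp_all add: fibre_monoid_def)
    \<comment> \<open>Only the occurrence of \<open>\<phi>\<close> on the right is expanded, so that
      both sides become instances of \<open>mkNT\<close> to be compared at points.\<close>
    show "\<one>\<^bsub>?A\<^esub> \<otimes>\<^bsub>?A\<^esub> \<phi> = \<phi>"
      by (subst (2) attractor_eq_mkNT[OF \<phi>]) (simp add: attractor_monoid_def, intro mkNT_eqI, simp add: *)
    show "\<phi> \<otimes>\<^bsub>?A\<^esub> \<one>\<^bsub>?A\<^esub> = \<phi>"
      by (subst (2) attractor_eq_mkNT[OF \<phi>]) (simp add: attractor_monoid_def, intro mkNT_eqI, simp add: *)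
  qed
qed

section \<open>Functoriality in the base\<close>

lemma attractor_pullback_mem:
  assumes "is_zfun T'" "is_submonoid N" "f \<in> over_hom T' \<tau>' T \<tau>" "\<phi> \<in> attractor X \<pi> \<alpha> N T \<tau>"
  shows "attractor_pullback N T' f \<phi> \<in> attractor X \<pi> \<alpha> N T' \<tau>'"
  unfolding attractor_pullback_eq using assms
  by (intro mkNT_in_attractor attracted_pullback[OF attractor_attracted])

lemma monoid_functor_attractor:
  fixes \<alpha> :: "('u, ((('m::comm_monoid_add \<Rightarrow>\<^sub>0 int) \<Rightarrow> 'u) \<times> 's) \<times> 'x, 'x) nt"
  assumes N: "is_submonoid N" and X: "monoid_over S X \<pi> \<mu> e"
    and act: "acts_by_monoid_endos (AA_base UNIV S) (\<lambda>R. snd) X \<pi> \<mu> e \<alpha>"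
  shows "monoid_functor S
    (attractor_monoid X \<pi> \<mu> e \<alpha> N :: ('u, 't) zfun \<Rightarrow> ('u, 't, 's) nt \<Rightarrow> _) (attractor_pullback N)"
  unfolding monoid_functor_def
proof (intro conjI allI impI ballI; elim conjE)
  fix T :: "('u, 't) zfun" and \<tau> :: "('u, 't, 's) nt" assume "scheme T" "\<tau> \<in> NT T S"
  then show "monoid (attractor_monoid X \<pi> \<mu> e \<alpha> N T \<tau>)"
    using attractor_monoid_monoid[OF scheme_zfun _ N X act] by blast
next
  fix T :: "('u, 't) zfun" and \<tau> :: "('u, 't, 's) nt" and \<phi>
  assume "\<phi> \<in> carrier (attractor_monoid X \<pi> \<mu> e \<alpha> N T \<tau>)"
  then have \<phi>: "\<phi> \<in> attractor X \<pi> \<alpha> N T \<tau>" by (simp add: attractor_monoid_def)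
  show "attractor_pullback N T (idNT T) \<phi> = \<phi>"
    by (subst (2) attractor_eq_mkNT[OF \<phi>])
      (auto simp: attractor_pullback_eq idNT_def pts_AA_base intro!: mkNT_eqI)
next
  fix T T' :: "('u, 't) zfun" and \<tau> \<tau>' :: "('u, 't, 's) nt" and f
  assume T': "scheme T'" and f: "f \<in> over_hom T' \<tau>' T \<tau>"
  have f': "f \<in> NT T' T" "\<And>R t. cring R \<Longrightarrow> t \<in> pts T' R \<Longrightarrow> \<tau> R (f R t) = \<tau>' R t"
    using f by (auto simp: over_hom_def)
  \<comment> \<open>Membership is \<open>attractor_pullback_mem\<close>. For products, both sides at
    \<open>(n, t)\<close> multiply the values of the two morphisms at
    \<open>(n, f R t)\<close>.\<close>
  show "attractor_pullback N T' f \<in> hom (attractor_monoid X \<pi> \<mu> e \<alpha> N T \<tau>) (attractor_monoid X \<pi> \<mu> e \<alpha> N T' \<tau>')"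
    using attractor_pullback_mem[OF scheme_zfun[OF T'] N f] NT_closed[OF f'(1)]
    by (auto simp: hom_def attractor_monoid_def)
      (auto simp: attractor_pullback_eq pts_AA_base intro!: mkNT_eqI)
  \<comment> \<open>At \<open>(n, t)\<close> both first components are the unit over
    \<open>\<tau>' R t\<close>, because \<open>f\<close> is a morphism over
    \<open>S\<close>.\<close>
  show "attractor_pullback N T' f \<one>\<^bsub>attractor_monoid X \<pi> \<mu> e \<alpha> N T \<tau>\<^esub> = \<one>\<^bsub>attractor_monoid X \<pi> \<mu> e \<alpha> N T' \<tau>'\<^esub>"
    using NT_closed[OF f'(1)]
    by (auto simp: attractor_monoid_def attractor_pullback_eq pts_AA_base f'(2) intro!: mkNT_eqI)
next
  fix T T' T'' :: "('u, 't) zfun" and \<tau> \<tau>' \<tau>'' :: "('u, 't, 's) nt" and f f' \<phi>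
  assume "f' \<in> over_hom T'' \<tau>'' T' \<tau>'"
  \<comment> \<open>\<open>f'\<close> carries points of \<open>T''\<close> to points of
    \<open>T'\<close>, so the inner \<open>mkNT\<close> can be evaluated at them.\<close>
  then have "f' \<in> NT T'' T'" by (simp add: over_hom_def)
  then show "attractor_pullback N T'' (compNT T'' f f') \<phi> =
      attractor_pullback N T'' f' (attractor_pullback N T' f \<phi>)"
    by (auto simp: attractor_pullback_eq compNT_def pts_AA_base NT_closed intro!: mkNT_eqI)
qed

section \<open>Groups\<close>

text \<open>Inversion is a morphism over \<open>S\<close>, so it preserves each fibre and supplies
  left inverses there; in a monoid these suffice.\<close>

lemma fibre_group:
  assumes X: "group_over S X \<pi> \<mu> e" and R: "cring R" and s: "s \<in> pts S R"
  shows "group (fibre_monoid X \<pi> \<mu> e R s)"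
proof -
  obtain \<iota> where \<iota>: "\<iota> \<in> over_hom X \<pi> X \<pi>"
    and inv: "\<And>x. x \<in> pts X R \<Longrightarrow> \<mu> R (\<iota> R x, x) = e R (\<pi> R x)"
    using X R by (auto simp: group_over_def)
  have "\<iota> R x \<in> pts X R \<and> \<pi> R (\<iota> R x) = \<pi> R x" if "x \<in> pts X R" for x
    using \<iota> that R by (auto simp: over_hom_def NT_closed)
  moreover have "monoid (fibre_monoid X \<pi> \<mu> e R s)"
    using X R s by (simp add: group_over_def monoid_over_def)
  ultimately show ?thesis
    using inv by (intro monoid.group_l_invI) (auto simp: fibre_monoid_def)
qed

text \<open>The clause on units is automatic: the fibres are groups, and homomorphisms of groups
  preserve the unit.\<close>

lemma acts_by_group_autos_imp_monoid_endos:
  fixes \<alpha> :: "('u, ((('m::comm_monoid_add \<Rightarrow>\<^sub>0 int) \<Rightarrow> 'u) \<times> 's) \<times> 'x, 'x) nt"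
  assumes X: "group_over S X \<pi> \<mu> e"
    and act: "acts_by_group_autos (AA_base UNIV S) (\<lambda>R. snd) X \<pi> \<mu> e \<alpha>"
  shows "acts_by_monoid_endos (AA_base UNIV S) (\<lambda>R. snd) X \<pi> \<mu> e \<alpha>"
  unfolding acts_by_monoid_endos_def
proof (intro allI impI ballI)
  fix R :: "'u ring" and g :: "(('m \<Rightarrow>\<^sub>0 int) \<Rightarrow> 'u) \<times> 's"
  assume R: "cring R" and g: "g \<in> pts (AA_base UNIV S) R"
  let ?G = "fibre_monoid X \<pi> \<mu> e R (snd g)"
  have G: "group ?G" using g by (intro fibre_group[OF X R]) (auto simp: pts_AA_base)
  have h: "(\<lambda>x. \<alpha> R (g, x)) \<in> hom ?G ?G"
    using act R g by (simp add: acts_by_group_autos_def iso_def)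
  then show "(\<lambda>x. \<alpha> R (g, x)) \<in> hom ?G ?G \<and> \<alpha> R (g, e R (snd g)) = e R (snd g)"
    using hom_one[OF h G G] by (simp add: fibre_monoid_def)
qed

text \<open>Inverses are formed pointwise with \<open>\<iota>\<close>. Since the monoid laws are
  already known, left inverses are enough.\<close>

lemma group_attractor_monoid:
  assumes T: "is_zfun T" and \<tau>: "\<tau> \<in> NT T S" and N: "is_submonoid N"
    and X: "group_over S X \<pi> \<mu> e"
    and act: "acts_by_group_autos (AA_base UNIV S) (\<lambda>R. snd) X \<pi> \<mu> e \<alpha>"
  shows "group (attractor_monoid X \<pi> \<mu> e \<alpha> N T \<tau>)" (is "group ?A")
proof -
  obtain \<iota> where \<iota>: "\<iota> \<in> over_hom X \<pi> X \<pi>"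
    and inv: "\<And>R x. cring R \<Longrightarrow> x \<in> pts X R \<Longrightarrow> \<mu> R (\<iota> R x, x) = e R (\<pi> R x)"
    using X by (auto simp: group_over_def)
  have \<iota>': "\<iota> R x \<in> pts X R" "\<pi> R (\<iota> R x) = \<pi> R x" if "cring R" "x \<in> pts X R" for R x
    using \<iota> that by (auto simp: over_hom_def NT_closed)
  have comm: "\<iota> R (\<alpha> R ((m, s), x)) = \<alpha> R ((m, s), \<iota> R x)"
    if R: "cring R" and m: "m \<in> rhom (monoid_ring UNIV) R" and s: "s \<in> pts S R"
      and x: "x \<in> pts X R" "\<pi> R x = s" for R m s x
  proof -
    let ?G = "fibre_monoid X \<pi> \<mu> e R s" and ?a = "\<lambda>x. \<alpha> R ((m, s), x)"
    have "?a \<in> hom ?G ?G"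
      using act R m s by (auto simp: acts_by_group_autos_def iso_def pts_AA_base)
    then interpret group_hom ?G ?G ?a
      using fibre_group[OF X R s] by (simp add: group_hom_def group_hom_axioms_def)
    \<comment> \<open>Uniqueness of inverses identifies \<open>\<iota>\<close> with the inverse of
      the fibre group, which every group homomorphism preserves.\<close>
    have \<iota>_inv: "\<iota> R y = inv\<^bsub>?G\<^esub> y" if "y \<in> carrier ?G" for y
      using that \<iota>'[OF R] inv[OF R]
      by (intro G.inv_equality[symmetric]) (auto simp: fibre_monoid_def)
    have "x \<in> carrier ?G" using x by (simp add: fibre_monoid_def)
    then show ?thesis using \<iota>_inv hom_inv hom_closed by simp
  qed
  have "monoid ?A"
    using X by (intro attractor_monoid_monoid[OF T \<tau> N _ acts_by_group_autos_imp_monoid_endos[OF X act]])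
      (simp add: group_over_def)
  then show ?thesis
  proof (rule monoid.group_l_invI)
    fix \<phi> assume "\<phi> \<in> carrier ?A"
    then have \<phi>: "\<phi> \<in> attractor X \<pi> \<alpha> N T \<tau>" by (simp add: attractor_monoid_def)
    let ?\<psi> = "mkNT (AA_base N T) (\<lambda>R p. (\<iota> R (fst (\<phi> R p)), snd p))"
    have "attracted X \<pi> \<alpha> N T \<tau> (\<lambda>R p. \<iota> R (fst (\<phi> R p)))"
      using attracted_inverse[OF \<iota> \<tau> _ attractor_attracted[OF \<phi>]] comm by blast
    then have "?\<psi> \<in> carrier ?A"
      using mkNT_in_attractor[OF T N] by (simp add: attractor_monoid_def)
    moreover have "?\<psi> \<otimes>\<^bsub>?A\<^esub> \<phi> = \<one>\<^bsub>?A\<^esub>"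
      using attracted_point[OF attractor_attracted[OF \<phi>], where \<mu> = \<mu> and e = e] inv
      by (simp add: attractor_monoid_def fibre_monoid_def, intro mkNT_eqI, simp)
    ultimately show "\<exists>\<psi>\<in>carrier ?A. \<psi> \<otimes>\<^bsub>?A\<^esub> \<phi> = \<one>\<^bsub>?A\<^esub>" by blast
  qed
qed

theorem proposition3p14:
  fixes S :: "('u, 's) zfun"
    and X :: "('u, 'x) zfun" and \<pi> :: "('u, 'x, 's) nt"
    and \<alpha> :: "('u, ((('m::comm_monoid_add \<Rightarrow>\<^sub>0 int) \<Rightarrow> 'u) \<times> 's) \<times> 'x, 'x) nt"
    and N :: "'m set"
  assumes "scheme S"
    and "algebraic_space S X \<pi>"
    and "AA_action S X \<pi> \<alpha>"
    and "is_submonoid N"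
  shows "(\<forall>\<mu> e. monoid_over S X \<pi> \<mu> e \<and>
            acts_by_monoid_endos (AA_base UNIV S) (\<lambda>R. snd) X \<pi> \<mu> e \<alpha> \<longrightarrow>
            monoid_functor S
              (attractor_monoid X \<pi> \<mu> e \<alpha> N :: ('u, 't) zfun \<Rightarrow> ('u, 't, 's) nt \<Rightarrow> _)
              (attractor_pullback N)) \<and>
         (\<forall>\<mu> e. group_over S X \<pi> \<mu> e \<and>
            acts_by_group_autos (AA_base UNIV S) (\<lambda>R. snd) X \<pi> \<mu> e \<alpha> \<longrightarrow>
            group_functor S
              (attractor_monoid X \<pi> \<mu> e \<alpha> N :: ('u, 't) zfun \<Rightarrow> ('u, 't, 's) nt \<Rightarrow> _)
              (attractor_pullback N))"
proof (intro conjI allI impI; elim conjE)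
  fix \<mu> e
  assume "monoid_over S X \<pi> \<mu> e"
    and "acts_by_monoid_endos (AA_base UNIV S) (\<lambda>R. snd) X \<pi> \<mu> e \<alpha>"
  then show "monoid_functor S
      (attractor_monoid X \<pi> \<mu> e \<alpha> N :: ('u, 't) zfun \<Rightarrow> ('u, 't, 's) nt \<Rightarrow> _)
      (attractor_pullback N)"
    by (rule monoid_functor_attractor[OF assms(4)])
next
  fix \<mu> e
  assume X: "group_over S X \<pi> \<mu> e"
    and act: "acts_by_group_autos (AA_base UNIV S) (\<lambda>R. snd) X \<pi> \<mu> e \<alpha>"
  have "monoid_over S X \<pi> \<mu> e" using X by (simp add: group_over_def)
  then show "group_functor S
      (attractor_monoid X \<pi> \<mu> e \<alpha> N :: ('u, 't) zfun \<Rightarrow> ('u, 't, 's) nt \<Rightarrow> _)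
      (attractor_pullback N)"
    \<comment> \<open>Group automorphisms of the fibres are monoid endomorphisms, so the monoid case
      applies and only inverses have to be added.\<close>
    using monoid_functor_attractor[OF assms(4) _ acts_by_group_autos_imp_monoid_endos[OF X act]]
      group_attractor_monoid[OF scheme_zfun _ assms(4) X act]
    by (auto simp: group_functor_def)
qed

end
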